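(* Let $n\ge 4$ and let $\mathcal{S}_n$ be the set of connected signed digraphs on $n$ vertices that contain exactly two signed directed cycles $C_{r_1}$ and $C_{r_2}$, these being vertex-disjoint and of even lengths $r_1,r_2$ with $2\le r_i\le n-2$ ($i=1,2$). Then: (i) If $n$ is even, the maximum of the iota energy $E_c(S)$ over $S\in\mathcal{S}_n$ is attained by a signed digraph whose two directed cycles are $C_2^-$ and $C_{n-2}^-$. (ii) If $n$ is odd, the maximum of $E_c(S)$ over $S\in\mathcal{S}_n$ is attained by a signed digraph whose two directed cycles are $C_2^-$ and $C_{n-3}^-$. (iii) The minimum of $E_c(S)$ over $S\in\mathcal{S}_n$ is attained by a signed digraph whose two directed cycles are both $C_2^+$.
   Context: A signed digraph (sidigraph) is a digraph $D=(V,A)$ together with a sign function $\sigma:A\to\{1,-1\}$; a directed cycle is positive (denoted $C_k^+$, $k$ its number of vertices) if the product of the signs of its arcs is $+1$ and negative ($C_k^-$) otherwise. It is connected if its underlying graph is connected. The adjacency matrix $A(S)=(a_{ij})$ has $a_{ij}=\sigma(v_iv_j)$ if $v_iv_j$ is an arc and $0$ otherwise. If $z_1,\dots,z_n$ are the eigenvalues of $A(S)$, the iota energy is $E_c(S)=\sum_{k=1}^n|\mathrm{Im}(z_k)|$. *)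

theory Defs
  imports
    "HOL-Computational_Algebra.Polynomial"
    "Graph_Theory.Pair_Digraph"
    "Graph_Theory.Digraph_Component"
    "Jordan_Normal_Form.Char_Poly"
begin

text \<open>Only the values of \<^term>\<open>arc_sign\<close> on the arcs are meaningful.\<close>

record 'a sidigraph =
  graph_of :: "'a pair_pre_digraph"
  arc_sign :: "'a \<times> 'a \<Rightarrow> int"

definition is_sidigraph :: "'a sidigraph \<Rightarrow> bool" where
  "is_sidigraph S \<longleftrightarrow>
     pair_digraph (graph_of S) \<and> (\<forall>a \<in> parcs (graph_of S). arc_sign S a \<in> {1, -1})"

definition sidigraph_connected :: "'a sidigraph \<Rightarrow> bool" where
  "sidigraph_connected S \<longleftrightarrow> Digraph_Component.connected (with_proj (graph_of S))"

text \<open>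
  The library represents a closed directed walk by its list of arcs, so that the rotations of a
  list describe one and the same directed cycle. A directed cycle is therefore identified with
  its set of arcs. Two opposite arcs form a directed cycle of length 2.
\<close>

definition dicycles :: "'a sidigraph \<Rightarrow> ('a \<times> 'a) set set" where
  "dicycles S = {set p | p. pre_digraph.cycle (with_proj (graph_of S)) p}"

definition cycle_verts :: "('a \<times> 'a) set \<Rightarrow> 'a set" where
  "cycle_verts C = fst ` C"

definition cycle_length :: "('a \<times> 'a) set \<Rightarrow> nat" where
  "cycle_length C = card (cycle_verts C)"

definition cycle_sign :: "'a sidigraph \<Rightarrow> ('a \<times> 'a) set \<Rightarrow> int" where
  "cycle_sign S C = (\<Prod>a\<in>C. arc_sign S a)"

definition is_pos_cycle :: "'a sidigraph \<Rightarrow> nat \<Rightarrow> ('a \<times> 'a) set \<Rightarrow> bool" where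
  "is_pos_cycle S k C \<longleftrightarrow> C \<in> dicycles S \<and> cycle_length C = k \<and> cycle_sign S C = 1"

definition is_neg_cycle :: "'a sidigraph \<Rightarrow> nat \<Rightarrow> ('a \<times> 'a) set \<Rightarrow> bool" where
  "is_neg_cycle S k C \<longleftrightarrow> C \<in> dicycles S \<and> cycle_length C = k \<and> cycle_sign S C \<noteq> 1"

text \<open>A sidigraph on \<open>n\<close> vertices has the vertex set \<open>{0..<n}\<close>, which indexes the matrix.\<close>

definition adj_matrix :: "nat sidigraph \<Rightarrow> complex mat" where
  "adj_matrix S = (let n = card (pverts (graph_of S)) in
     mat n n (\<lambda>(i, j). if (i, j) \<in> parcs (graph_of S) then of_int (arc_sign S (i, j)) else 0))"

text \<open>
  The roots of the characteristic polynomial form a multiset, hence each eigenvalue is counted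
  with its algebraic multiplicity.
\<close>

definition iota_energy :: "nat sidigraph \<Rightarrow> real" where
  "iota_energy S = (\<Sum>z\<in>#proots (char_poly (adj_matrix S)). \<bar>Im z\<bar>)"

definition two_even_cycle_class :: "nat \<Rightarrow> nat sidigraph set" where
  "two_even_cycle_class n =
     {S. is_sidigraph S \<and> pverts (graph_of S) = {0..<n} \<and> sidigraph_connected S \<and>
         (\<exists>C1 C2. C1 \<noteq> C2 \<and> dicycles S = {C1, C2} \<and>
            cycle_verts C1 \<inter> cycle_verts C2 = {} \<and>
            (\<forall>C \<in> {C1, C2}. even (cycle_length C) \<and> 2 \<le> cycle_length C \<and> cycle_length C \<le> n - 2))}"

end

theory Submission
  imports Defs "HOL-Analysis.Convex" "HOL-Combinatorics.Cycles"
begin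

text \<open>
  In the Leibniz expansion of the characteristic polynomial, a permutation contributes only if each of
  its nontrivial orbits is a directed cycle. With exactly two directed cycles, disjoint and of even
  lengths \<open>a\<close>, \<open>b\<close> and signs \<open>s\<close>, \<open>t\<close>, only four permutations remain and the polynomial is
  \<open>x^(n-a-b) (x^a - s) (x^b - t)\<close>. An even cycle of length \<open>r\<close> thus contributes
  \<open>2 cot (pi/r)\<close> to the energy if it is positive and \<open>2 / sin (pi/r)\<close> if it is negative.
  The minimum is \<open>0 = 4 cot (pi/2)\<close>; the maximum follows from the convexity of
  \<open>x \<mapsto> 1 / sin (pi/x)\<close> on \<open>[2, \<infinity>)\<close>.
\<close>

section \<open>Energy contributed by a single even cycle\<close>

definition cycle_energy :: "nat \<Rightarrow> int \<Rightarrow> real" where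
  "cycle_energy r s = (\<Sum>z\<in>{z::complex. z ^ r = of_int s}. \<bar>Im z\<bar>)"

text \<open>A nonzero complex number has \<open>r\<close> distinct \<open>r\<close>-th roots, which
  already exhaust the degree, so every root is simple. This is why \<open>cycle_energy\<close> may
  sum over a set instead of a multiset.\<close>

lemma proots_monom_diff_const:
  fixes c :: complex
  assumes "0 < r" "c \<noteq> 0"
  shows "proots (monom 1 r - [:c:]) = mset_set {z. z ^ r = c}"
proof -
  let ?p = "monom 1 r - [:c:] :: complex poly"
  have deg: "degree ?p = r"
    using assms by (subst diff_conv_add_uminus, subst degree_add_eq_left) (auto simp: degree_monom_eq)
  hence "?p \<noteq> 0" using assms by auto
  hence set: "set_mset (proots ?p) = {z. z ^ r = c}"
    by (auto simp: poly_monom)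
  have "mset_set (set_mset (proots ?p)) \<subseteq># proots ?p"
    by (rule mset_set_set_mset_msubset)
  moreover have "size (mset_set (set_mset (proots ?p))) = size (proots ?p)"
    using assms by (simp add: set size_proots_complex deg card_nth_roots)
  ultimately show ?thesis
    unfolding set by (metis mset_subset_size nless_le subset_mset.less_le)
qed

text \<open>The angles for \<open>k\<close> and \<open>k + h\<close> differ by pi, so the second
  half of the sum repeats the first, where all sines are nonnegative. The factor
  \<open>sin (pi / (2 * h))\<close>, taken at half the spacing of the angles, makes the remaining
  sum telescope. The offset \<phi> serves both signs of a cycle.\<close>

lemma sum_abs_sin_equidistributed:
  fixes h :: nat and \<phi> :: real
  assumes "0 < h" "0 \<le> \<phi>" "\<phi> \<le> pi / h"
  shows "(\<Sum>k<2*h. \<bar>sin (\<phi> + pi * real k / h)\<bar>) * sin (pi / (2 * h)) = 2 * cos (\<phi> - pi / (2 * h))"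
proof -
  let ?t = "\<lambda>k::nat. \<phi> + pi * k / h"
  let ?d = "pi / (2 * h)"
  have nonneg: "sin (?t k) \<ge> 0" if "k < h" for k
  proof (rule sin_ge_zero)
    have "?t k \<le> pi / h + pi * k / h" using assms by simp
    also have "\<dots> = pi * (real k + 1) / h" by (simp add: add_divide_distrib algebra_simps)
    also have "\<dots> \<le> pi * h / h"
    proof (intro divide_right_mono mult_left_mono)
      show "real k + 1 \<le> real h" using that by linarith
    qed auto
    finally show "?t k \<le> pi" using assms by simp
  qed (use assms in auto)
  have shift: "sin (?t (k + h)) = - sin (?t k)" for k
  proof -
    have "?t (k + h) = ?t k + pi" using assms by (simp add: field_simps)
    thus ?thesis by (simp only: sin_periodic_pi)
  qed
  have "(\<Sum>k<2*h. \<bar>sin (?t k)\<bar>) = (\<Sum>k<h. \<bar>sin (?t k)\<bar>) + (\<Sum>k=h..<h+h. \<bar>sin (?t k)\<bar>)"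
    by (subst sum.union_disjoint[symmetric]) (auto intro!: sum.cong simp: mult_2)
  also have "(\<Sum>k=h..<h+h. \<bar>sin (?t k)\<bar>) = (\<Sum>k<h. \<bar>sin (?t (k + h))\<bar>)"
    using sum.shift_bounds_nat_ivl[of "\<lambda>k. \<bar>sin (?t k)\<bar>" 0 h h] by (simp add: atLeast0LessThan)
  also have "\<dots> = (\<Sum>k<h. \<bar>sin (?t k)\<bar>)" by (simp only: shift abs_minus)
  finally have half: "(\<Sum>k<2*h. \<bar>sin (?t k)\<bar>) = 2 * (\<Sum>k<h. sin (?t k))"
    using nonneg by simp
  \<comment> \<open>Product-to-sum formula: the angles are \<open>2 * ?d\<close> apart, so
    \<open>?t k + ?d\<close> is \<open>?t (Suc k) - ?d\<close>.\<close>
  have step: "2 * (sin (?t k) * sin ?d) = cos (?t k - ?d) - cos (?t (Suc k) - ?d)" for k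
  proof -
    have "?t (Suc k) - ?d = ?t k + ?d" using assms by (simp add: field_simps)
    thus ?thesis by (simp add: cos_add cos_diff)
  qed
  have "(\<Sum>k<2*h. \<bar>sin (?t k)\<bar>) * sin ?d = (\<Sum>k<h. 2 * (sin (?t k) * sin ?d))"
    unfolding half by (simp add: sum_distrib_left sum_distrib_right mult_ac)
  also have "\<dots> = cos (?t 0 - ?d) - cos (?t h - ?d)"
    unfolding step by (subst sum_lessThan_telescope'[symmetric]) simp
  also have "?t h - ?d = (\<phi> - ?d) + pi" using assms by simp
  finally show ?thesis by (simp only: cos_periodic_pi) simp
qed

text \<open>Rotating the roots of unity by \<open>cis \<phi>\<close> yields the required roots, and
  their imaginary parts are the sines just summed.\<close>

lemma cycle_energy_cis:
  fixes h :: nat and \<phi> :: real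
  assumes "0 < h" "of_int s = cis (2 * h * \<phi>)"
  shows "cycle_energy (2 * h) s = (\<Sum>k<2*h. \<bar>sin (\<phi> + pi * real k / h)\<bar>)"
proof -
  have bij: "bij_betw (\<lambda>k. cis (\<phi> + pi * real k / h)) {..<2*h} {z. z ^ (2*h) = of_int s}"
  proof -
    have b1: "bij_betw (\<lambda>k. cis (2 * pi * real k / real (2*h))) {..<2*h} {z. z ^ (2*h) = 1}"
      using assms by (intro bij_betw_roots_unity) simp
    have pow: "cis \<phi> ^ (2 * h) = of_int s"
      using assms by (simp add: DeMoivre mult_ac)
    have b2: "bij_betw (\<lambda>z. cis \<phi> * z) {z. z ^ (2*h) = 1} {z. z ^ (2*h) = of_int s}"
    proof (rule bij_betw_byWitness[where f' = "\<lambda>z. z / cis \<phi>"])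
      show "(*) (cis \<phi>) ` {z. z ^ (2*h) = 1} \<subseteq> {z. z ^ (2*h) = of_int s}"
        by (auto simp: power_mult_distrib pow)
      show "(\<lambda>z. z / cis \<phi>) ` {z. z ^ (2*h) = of_int s} \<subseteq> {z. z ^ (2*h) = 1}"
        by (auto simp: power_divide pow assms)
    qed auto
    show ?thesis
      using bij_betw_trans[OF b1 b2] by (simp add: o_def cis_mult)
  qed
  show ?thesis
    unfolding cycle_energy_def
    by (subst sum.reindex_bij_betw[OF bij, symmetric]) simp
qed

lemma cycle_energy_pos:
  assumes "even r" "2 \<le> r"
  shows "cycle_energy r 1 = 2 * cos (pi / r) / sin (pi / r)"
proof -
  from \<open>even r\<close> obtain h where h: "r = 2 * h" by blast
  have "sin (pi / r) > 0" using assms by (intro sin_gt_zero) (auto simp: field_simps)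
  moreover have "cycle_energy r 1 * sin (pi / r) = 2 * cos (pi / r)"
    using cycle_energy_cis[of h 1 0] sum_abs_sin_equidistributed[of h 0] assms h by simp
  ultimately show ?thesis by (simp add: field_simps)
qed

lemma cycle_energy_neg:
  assumes "even r" "2 \<le> r"
  shows "cycle_energy r (- 1) = 2 / sin (pi / r)"
proof -
  from \<open>even r\<close> obtain h where h: "r = 2 * h" by blast
  have "sin (pi / r) > 0" using assms by (intro sin_gt_zero) (auto simp: field_simps)
  moreover have "cycle_energy r (- 1) * sin (pi / r) = 2"
  proof -
    \<comment> \<open>The offset for a negative cycle is half the spacing \<open>pi / h\<close>; it
      cancels the shift inside the cosine and leaves \<open>2 * cos 0\<close>.\<close>
    have "cis (2 * h * (pi / r)) = of_int (- 1)" using assms h by (simp add: cis_pi)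
    moreover have "pi / real r \<le> pi / real h"
      using assms h by (intro divide_left_mono) auto
    ultimately show ?thesis
      using cycle_energy_cis[of h "- 1" "pi / r"] sum_abs_sin_equidistributed[of h "pi / r"]
        assms h by simp
  qed
  ultimately show ?thesis by (simp add: field_simps)
qed

lemma cycle_energy_nonneg: "0 \<le> cycle_energy r s"
  by (simp add: cycle_energy_def sum_nonneg)

text \<open>The two possible values differ only by the factor \<open>cos (pi / r)\<close>, which is
  at most 1.\<close>

lemma cycle_energy_le_neg:
  assumes "even r" "2 \<le> r" "s \<in> {1, - 1}"
  shows "cycle_energy r s \<le> cycle_energy r (- 1)"
proof -
  have "sin (pi / r) > 0" using assms by (intro sin_gt_zero) (auto simp: field_simps)
  thus ?thesis
    using assms by (auto simp: cycle_energy_pos cycle_energy_neg intro!: divide_right_mono)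
qed

section \<open>Convexity and the comparison of cycle lengths\<close>

text \<open>In the variable \<open>t = pi / x\<close> the derivative is \<open>?g t / pi\<close>.
  Since \<open>t\<close> decreases as \<open>x\<close> grows, it is enough that \<open>?g\<close> is
  nonincreasing for \<open>0 < t \<le> pi / 2\<close>.\<close>

lemma convex_on_inverse_sin_pi_div:
  "convex_on {2..} (\<lambda>x::real. 1 / sin (pi / x))"
proof (rule convex_on_realI)
  let ?g = "\<lambda>t::real. t\<^sup>2 * cos t / (sin t)\<^sup>2"
  show "((\<lambda>x. 1 / sin (pi / x)) has_real_derivative ?g (pi / x) / pi) (at x)"
    if "x \<in> {2..}" for x :: real
  proof -
    have "sin (pi / x) > 0" using that by (intro sin_gt_zero) (auto simp: field_simps)
    thus ?thesis
      using that by (auto intro!: derivative_eq_intros simp: power2_eq_square field_simps)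
  qed
  have anti: "?g u \<ge> ?g v" if "0 < u" "u \<le> v" "v \<le> pi / 2" for u v :: real
  proof (rule DERIV_nonpos_imp_nonincreasing[OF \<open>u \<le> v\<close>])
    fix t assume t: "u \<le> t" "t \<le> v"
    have pos: "sin t > 0" using t that by (intro sin_gt_zero) auto
    \<comment> \<open>The derivative of \<open>?g\<close> after cancelling one factor
      \<open>sin t\<close>; only the bracket still needs a sign.\<close>
    let ?D = "t * (2 * sin t * cos t - t * (1 + (cos t)\<^sup>2)) / (sin t) ^ 3"
    have "(?g has_real_derivative ?D) (at t)"
    proof -
      have "(?g has_real_derivative
          (((2 * t * cos t - t\<^sup>2 * sin t) * (sin t)\<^sup>2 - t\<^sup>2 * cos t * (2 * sin t * cos t))
            / ((sin t)\<^sup>2 * (sin t)\<^sup>2))) (at t)"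
        using pos by (auto intro!: derivative_eq_intros simp: power2_eq_square)
      also have "((2 * t * cos t - t\<^sup>2 * sin t) * (sin t)\<^sup>2 - t\<^sup>2 * cos t * (2 * sin t * cos t))
          = sin t * (t * (2 * sin t * cos t - t * ((sin t)\<^sup>2 + 2 * (cos t)\<^sup>2)))"
        by (simp add: power2_eq_square algebra_simps)
      also have "(sin t)\<^sup>2 + 2 * (cos t)\<^sup>2 = 1 + (cos t)\<^sup>2"
        using sin_cos_squared_add[of t] by linarith
      finally show ?thesis
        using pos by (simp add: power2_eq_square power3_eq_cube mult.assoc)
    qed
    moreover have "?D \<le> 0"
    proof -
      have cos: "cos t \<ge> 0" using t that by (intro cos_ge_zero) auto
      \<comment> \<open>The bracket is nonpositive by \<open>sin t \<le> t\<close> followed by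
        \<open>2 * cos t \<le> 1 + (cos t)^2\<close>.\<close>
      have "2 * sin t * cos t \<le> 2 * t * cos t"
        using sin_x_le_x[of t] t that cos by (intro mult_right_mono) auto
      also have "\<dots> \<le> t * (1 + (cos t)\<^sup>2)"
        using mult_left_mono[of "2 * cos t" "1 + (cos t)\<^sup>2" t] t that
          zero_le_power2[of "1 - cos t"] by (simp add: power2_diff mult_ac)
      finally show ?thesis
        using pos t that by (auto intro!: divide_nonpos_pos mult_nonneg_nonpos)
    qed
    ultimately show "\<exists>y. (?g has_real_derivative y) (at t) \<and> y \<le> 0" by blast
  qed
  show "?g (pi / x) / pi \<le> ?g (pi / y) / pi"
    if "x \<in> {2..}" "y \<in> {2..}" "x \<le> y" for x y :: real
  proof (rule divide_right_mono[OF anti])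
    show "pi / y \<le> pi / x" using that by (intro divide_left_mono) auto
    show "pi / x \<le> pi / 2" using that by (intro divide_left_mono) auto
  qed (use that in auto)
qed (auto intro: convex_connected)

text \<open>For a fixed sum of the arguments a convex function has its largest total when they are
  as far apart as possible, here at 2 and \<open>m\<close>; the summand 1 is the value at 2.\<close>

lemma inverse_sin_pi_div_sum_le:
  fixes a b m :: real
  assumes "2 \<le> a" "2 \<le> b" "a + b \<le> m + 2"
  shows "1 / sin (pi / a) + 1 / sin (pi / b) \<le> 1 + 1 / sin (pi / m)"
\<comment> \<open>The interpolation weight \<open>u\<close> divides by \<open>m - 2\<close>.\<close>
proof (cases "m = 2")
  case True
  with assms have "a = 2" "b = 2" by auto
  with True show ?thesis by simp
next
  case False
  let ?f = "\<lambda>x::real. 1 / sin (pi / x)"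
  have "m > 2" using assms False by auto
  \<comment> \<open>The largest value open to \<open>b\<close>. The points \<open>a\<close> and
    \<open>c\<close> are mirror images in the interval from 2 to \<open>m\<close>, so their weights
    \<open>u\<close> and \<open>1 - u\<close> are exchanged and the two convexity bounds add up to
    the claim.\<close>
  define c where "c = m + 2 - a"
  define u where "u = (a - 2) / (m - 2)"
  have u: "0 \<le> u" "u \<le> 1" using assms \<open>m > 2\<close> by (auto simp: u_def field_simps)
  have "u * (m - 2) = a - 2" using \<open>m > 2\<close> by (simp add: u_def)
  hence a: "a = (1 - u) * 2 + u * m" and c: "c = (1 - (1 - u)) * 2 + (1 - u) * m"
    by (simp_all add: c_def algebra_simps)
  have "?f a \<le> (1 - u) * ?f 2 + u * ?f m"
    using convex_onD[OF convex_on_inverse_sin_pi_div, of u 2 m] u \<open>m > 2\<close> unfolding a by simp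
  moreover have "?f c \<le> (1 - (1 - u)) * ?f 2 + (1 - u) * ?f m"
    using convex_onD[OF convex_on_inverse_sin_pi_div, of "1 - u" 2 m] u \<open>m > 2\<close> unfolding c
    by simp
  \<comment> \<open>\<open>?f\<close> increases, because \<open>pi / x\<close> stays in the range
    where sine is monotone.\<close>
  moreover have "?f b \<le> ?f c"
  proof (rule divide_left_mono)
    have "b \<le> c" using assms by (simp add: c_def)
    hence "pi / c \<le> pi / b" using assms by (intro divide_left_mono) auto
    moreover have "pi / b \<le> pi / 2" using assms by (intro divide_left_mono) auto
    moreover have "- (pi / 2) \<le> pi / c"
      using assms \<open>b \<le> c\<close> by (intro order_trans[OF _ divide_nonneg_nonneg[of pi c]]) auto
    ultimately show "sin (pi / c) \<le> sin (pi / b)"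
      by (intro sin_monotone_2pi_le) auto
    have "0 < sin (pi / c)" "0 < sin (pi / b)"
      using assms \<open>b \<le> c\<close> by (auto intro!: sin_gt_zero simp: field_simps)
    thus "0 < sin (pi / b) * sin (pi / c)" by auto
  qed simp
  ultimately show ?thesis by (simp add: algebra_simps diff_divide_distrib)
qed

text \<open>First both cycles are made negative, then their lengths are pushed apart to 2 and
  \<open>m\<close>.\<close>

lemma cycle_energy_sum_le:
  assumes "even a" "2 \<le> a" "even b" "2 \<le> b" "even m" "a + b \<le> m + 2"
    and "s \<in> {1, - 1}" "t \<in> {1, - 1}"
  shows "cycle_energy a s + cycle_energy b t \<le> cycle_energy 2 (- 1) + cycle_energy m (- 1)"
proof -
  have "cycle_energy a s + cycle_energy b t \<le> cycle_energy a (- 1) + cycle_energy b (- 1)"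
    using assms by (intro add_mono cycle_energy_le_neg)
  also have "\<dots> \<le> cycle_energy 2 (- 1) + cycle_energy m (- 1)"
    using inverse_sin_pi_div_sum_le[of a b m] assms by (simp add: cycle_energy_neg)
  finally show ?thesis .
qed

section \<open>Directed cycles as cyclic permutations\<close>

lemma sign_cycle_of_list:
  assumes "distinct vs"
  shows "sign (cycle_of_list vs) = (- 1) ^ (length vs - 1)"
  using assms
proof (induction vs rule: cycle_of_list.induct)
  case (1 i j cs)
  thus ?case
    by (simp add: sign_compose permutation_swap_id permutation_of_cycle sign_swap_id
        del: o_apply)
qed simp_all

lemma pcas_verts_eq: "pcas u p v \<Longrightarrow> u # map snd p = map fst p @ [v]"
  by (induction p arbitrary: u) auto

lemma pcas_append: "pcas u (p @ q) v \<longleftrightarrow> (\<exists>w. pcas u p w \<and> pcas w q v)"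
  by (induction p arbitrary: u) auto

lemma pawalk_verts_eq: "pcas u p v \<Longrightarrow> pawalk_verts u p = u # map snd p"
  by (induction p arbitrary: u) auto

lemma dicycles_iff:
  "C \<in> dicycles S \<longleftrightarrow>
    (\<exists>u p. u \<in> pverts (graph_of S) \<and> set p \<subseteq> parcs (graph_of S) \<and> pcas u p u \<and>
      distinct (map snd p) \<and> p \<noteq> [] \<and> C = set p)"
  unfolding dicycles_def pre_digraph.cycle_def pre_digraph.awalk_def
    cas_with_proj_eq awalk_verts_with_proj_eq
  by (auto simp: pawalk_verts_eq) (metis list.sel(3) pawalk_verts_eq)+

text \<open>The list \<open>vs\<close> consists of the tails of the arcs in walking order. In a
  closed walk the list of heads is this list rotated by one, so the cyclic permutation of
  \<open>vs\<close> maps each tail to its head, and the cycle is the graph of that permutation on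
  its vertices.\<close>

lemma dicycle_cycle_of_list:
  assumes "C \<in> dicycles S"
  obtains vs where "distinct vs" "set vs = cycle_verts C" "length vs = cycle_length C"
    "C = (\<lambda>v. (v, cycle_of_list vs v)) ` set vs"
proof -
  from assms obtain u p where p: "pcas u p u" "distinct (map snd p)" "p \<noteq> []" "C = set p"
    unfolding dicycles_iff by blast
  let ?vs = "map fst p"
  have eq: "u # map snd p = ?vs @ [u]" using p by (intro pcas_verts_eq)
  hence rot: "map snd p = rotate1 ?vs" using p by (cases p) auto
  hence dist: "distinct ?vs" using p(2) by (metis distinct1_rotate)
  have set: "set ?vs = cycle_verts C" by (simp add: p cycle_verts_def)
  have "map (cycle_of_list ?vs) ?vs = map snd p"
    using cyclic_rotation[OF dist, of 1] rot by simp
  hence "cycle_of_list ?vs (fst a) = snd a" if "a \<in> set p" for a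
    using that by simp
  hence "C = (\<lambda>v. (v, cycle_of_list ?vs v)) ` set ?vs"
    by (force simp: p image_image)
  moreover have "length ?vs = cycle_length C"
    using distinct_card[OF dist] by (simp only: set cycle_length_def)
  ultimately show ?thesis using that dist set by blast
qed

text \<open>Iterating \<open>p\<close> from a moved point traces a closed walk that returns after
  \<open>least_power p i\<close> steps; \<open>U\<close> is the orbit. The heads are distinct
  because \<open>p\<close> is injective on it.\<close>

lemma orbit_dicycle:
  assumes p: "p permutes pverts (graph_of S)" and fin: "finite (pverts (graph_of S))"
    and arcs: "\<And>i. p i \<noteq> i \<Longrightarrow> (i, p i) \<in> parcs (graph_of S)" and i: "p i \<noteq> i"
  obtains U where "i \<in> U" "(\<lambda>j. (j, p j)) ` U \<in> dicycles S"
proof -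
  have perm: "permutation p" using p fin permutation_permutes by blast
  define k where "k = least_power p i"
  have k: "(p ^^ k) i = i" "k > 0"
    using least_power_of_permutation[OF perm] by (auto simp: k_def)
  define L where "L = (\<lambda>m. map (\<lambda>j. ((p ^^ j) i, p ((p ^^ j) i))) [0..<m])"
  \<comment> \<open>The whole orbit is moved, so the hypothesis on arcs applies to each of its
    points.\<close>
  have moved: "p ((p ^^ j) i) \<noteq> (p ^^ j) i" for j
  proof
    assume "p ((p ^^ j) i) = (p ^^ j) i"
    hence "(p ^^ j) (p i) = (p ^^ j) i" by (metis funpow_swap1)
    thus False using i p by (metis bij_def bij_fn inj_eq permutes_bij)
  qed
  have cas: "pcas i (L m) ((p ^^ m) i)" for m
    by (induction m) (auto simp: L_def pcas_append)
  have "distinct (map p (support p i))"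
    using cycle_of_permutation[OF perm, of i] permutes_inj[OF p]
    by (subst distinct_map) (auto intro: inj_on_subset)
  hence "distinct (map snd (L k))" by (simp add: L_def k_def o_def)
  moreover have "i \<in> pverts (graph_of S)" using i p by (meson permutes_not_in)
  moreover have "set (L k) \<subseteq> parcs (graph_of S)" using arcs moved by (auto simp: L_def)
  moreover have "L k \<noteq> []" using k by (simp add: L_def)
  ultimately have "set (L k) \<in> dicycles S"
    using cas[of k] k unfolding dicycles_iff by (metis (no_types))
  moreover have "set (L k) = (\<lambda>j. (j, p j)) ` ((\<lambda>j. (p ^^ j) i) ` {0..<k})"
    by (auto simp: L_def)
  moreover have "i \<in> (\<lambda>j. (p ^^ j) i) ` {0..<k}"
    using k by (intro image_eqI[of _ _ 0]) auto
  ultimately show ?thesis using that by metis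
qed

section \<open>Leibniz expansion of the characteristic polynomial\<close>

text \<open>Without loops the diagonal entries are all \<open>x\<close>, so each fixed point gives a
  factor \<open>x\<close> and each point of \<open>W\<close> a negated arc sign.\<close>

lemma adj_char_poly_matrix_prod:
  assumes "is_sidigraph S" "pverts (graph_of S) = {0..<n}" "W \<subseteq> {0..<n}"
    and W: "\<And>i. i \<in> W \<Longrightarrow> (i, q i) \<in> parcs (graph_of S)" and fixed: "\<And>i. i \<notin> W \<Longrightarrow> q i = i"
  shows "(\<Prod>i=0..<n. char_poly_matrix (adj_matrix S) $$ (i, q i)) =
    monom (\<Prod>i\<in>W. - of_int (arc_sign S (i, q i))) (n - card W)"
proof -
  let ?M = "char_poly_matrix (adj_matrix S)"
  interpret pair_digraph "graph_of S" using assms(1) by (simp add: is_sidigraph_def)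
  have loop: "(i, i) \<notin> parcs (graph_of S)" for i using pair_no_loops[of "(i, i)"] by auto
  have entry: "?M $$ (i, q i) = (if i \<in> W then [:- of_int (arc_sign S (i, q i)):] else [:0, 1:])"
    if "i < n" for i
  proof -
    have "q i < n" 
      using W[of i] fixed[of i] that in_arcsD2[of i "q i"] assms(2) by (cases "i \<in> W") auto
    moreover have "q i \<noteq> i" if "i \<in> W" using W[OF that] loop by metis
    ultimately show ?thesis
      using that W[of i] fixed[of i] loop
      by (auto simp: char_poly_matrix_def adj_matrix_def Let_def assms(2))
  qed
  have "(\<Prod>i=0..<n. ?M $$ (i, q i)) =
    (\<Prod>i\<in>W. ?M $$ (i, q i)) * (\<Prod>i\<in>{0..<n} - W. ?M $$ (i, q i))"
    using assms(3) by (intro prod.subset_diff[THEN trans[OF _ mult.commute]]) auto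
  also have "(\<Prod>i\<in>W. ?M $$ (i, q i)) = (\<Prod>i\<in>W. [:- of_int (arc_sign S (i, q i)):])"
    using assms(3) by (intro prod.cong) (auto simp: entry)
  also have "\<dots> = [:\<Prod>i\<in>W. - of_int (arc_sign S (i, q i)):]"
    by (induction W rule: infinite_finite_induct) (auto simp: one_pCons)
  also have "(\<Prod>i\<in>{0..<n} - W. ?M $$ (i, q i)) = (\<Prod>i\<in>{0..<n} - W. [:0, 1:])"
    by (intro prod.cong) (auto simp: entry)
  also have "\<dots> = [:0, 1:] ^ (n - card W)"
    using assms(3) by (simp add: card_Diff_subset finite_subset)
  finally show ?thesis by (simp add: monom_altdef)
qed

text \<open>The surviving permutations are \<open>id\<close>, the two cyclic permutations and their
  composite. An even cycle is an odd permutation, and the minus signs on its arcs cancel, so it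
  contributes the negative of its sign. The bound on the lengths is proved first because it keeps
  the subtractions in the exponents from truncating.\<close>

lemma char_poly_two_dicycles:
  assumes S: "is_sidigraph S" "pverts (graph_of S) = {0..<n}"
    and cyc: "dicycles S = {C1, C2}" and disj: "cycle_verts C1 \<inter> cycle_verts C2 = {}"
    and even: "even (cycle_length C1)" "even (cycle_length C2)"
  shows "cycle_length C1 + cycle_length C2 \<le> n"
    and "char_poly (adj_matrix S) =
      monom 1 (n - (cycle_length C1 + cycle_length C2)) *
      ((monom 1 (cycle_length C1) - [:of_int (cycle_sign S C1):]) *
       (monom 1 (cycle_length C2) - [:of_int (cycle_sign S C2):]))"
proof -
  interpret pair_digraph "graph_of S" using S by (simp add: is_sidigraph_def)
  let ?E = "parcs (graph_of S)"
  let ?r1 = "cycle_length C1" and ?r2 = "cycle_length C2"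
  let ?s1 = "of_int (cycle_sign S C1) :: complex" and ?s2 = "of_int (cycle_sign S C2) :: complex"
  have mem: "C1 \<in> dicycles S" "C2 \<in> dicycles S" using cyc by auto
  obtain vs1 where vs1: "distinct vs1" "set vs1 = cycle_verts C1" "length vs1 = ?r1"
    "C1 = (\<lambda>v. (v, cycle_of_list vs1 v)) ` set vs1"
    using mem(1) by (rule dicycle_cycle_of_list)
  obtain vs2 where vs2: "distinct vs2" "set vs2 = cycle_verts C2" "length vs2 = ?r2"
    "C2 = (\<lambda>v. (v, cycle_of_list vs2 v)) ` set vs2"
    using mem(2) by (rule dicycle_cycle_of_list)
  let ?V1 = "set vs1" and ?V2 = "set vs2"
  define c1 where "c1 = cycle_of_list vs1"
  define c2 where "c2 = cycle_of_list vs2"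
  have V: "?V1 \<inter> ?V2 = {}" using disj unfolding vs1(2) vs2(2) .
  have sub: "C \<subseteq> ?E" "C \<noteq> {}" if "C \<in> dicycles S" for C using that by (auto simp: dicycles_iff)
  note g1 = vs1(4)[folded c1_def] and g2 = vs2(4)[folded c2_def]
  have E1: "(i, c1 i) \<in> ?E" if "i \<in> ?V1" for i
    using sub(1)[OF mem(1)] that g1 by blast
  have E2: "(i, c2 i) \<in> ?E" if "i \<in> ?V2" for i
    using sub(1)[OF mem(2)] that g2 by blast
  have ne: "?V1 \<noteq> {}" "?V2 \<noteq> {}" using sub(2)[OF mem(1)] sub(2)[OF mem(2)] g1 g2 by blast+
  have loop: "(i, i) \<notin> ?E" for i using pair_no_loops[of "(i, i)"] by auto
  have moved: "c1 i \<noteq> i" if "i \<in> ?V1" for i using E1[OF that] loop by metis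
  have moved2: "c2 i \<noteq> i" if "i \<in> ?V2" for i using E2[OF that] loop by metis
  have id1: "c1 i = i" if "i \<notin> ?V1" for i using that by (simp add: c1_def id_outside_supp)
  have id2: "c2 i = i" if "i \<notin> ?V2" for i using that by (simp add: c2_def id_outside_supp)
  have Vn: "?V1 \<subseteq> {0..<n}" "?V2 \<subseteq> {0..<n}" using E1 E2 in_arcsD1 S(2) by blast+
  have p1: "c1 permutes ?V1" and p2: "c2 permutes ?V2"
    by (simp_all add: c1_def c2_def cycle_permutes)
  have p1n: "c1 permutes {0..<n}" and p2n: "c2 permutes {0..<n}"
    using p1 p2 Vn by (auto intro: permutes_subset)
  have card: "card ?V1 = ?r1" "card ?V2 = ?r2" unfolding vs1(2) vs2(2) cycle_length_def by (rule refl)+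
  have cardU: "card (?V1 \<union> ?V2) = ?r1 + ?r2" using V card by (simp add: card_Un_disjoint)
  show len: "?r1 + ?r2 \<le> n"
    using card_mono[of "{0..<n}" "?V1 \<union> ?V2"] Vn cardU by simp
  have r: "?r1 \<noteq> 0" "?r2 \<noteq> 0"
    using card ne card_eq_0_iff[of ?V1] card_eq_0_iff[of ?V2] by (metis List.finite_set)+
  have sg1: "sign c1 = - 1"
    using sign_cycle_of_list[OF vs1(1)] vs1(3) even r by (simp add: c1_def)
  have sg2: "sign c2 = - 1"
    using sign_cycle_of_list[OF vs2(1)] vs2(3) even r by (simp add: c2_def)
  have perms: "permutation c1" "permutation c2"
    by (simp_all add: c1_def c2_def permutation_of_cycle)
  have sg12: "sign (c1 \<circ> c2) = 1"
    using sign_compose[OF perms] sg1 sg2 by simp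
  \<comment> \<open>The composite acts on each cycle separately, as \<open>c2\<close> preserves
    \<open>?V2\<close> and fixes \<open>?V1\<close>.\<close>
  have c12: "(c1 \<circ> c2) i = (if i \<in> ?V1 then c1 i else c2 i)" for i
  proof -
    have "c2 i \<in> ?V2" if "i \<in> ?V2" using permutes_in_image[OF p2] that by simp
    thus ?thesis using V id1 id2 by (cases "i \<in> ?V2") (auto; metis IntI empty_iff)+
  qed
  have prod1: "(\<Prod>i\<in>?V1. - of_int (arc_sign S (i, c1 i))) = ?s1"
  proof -
    have "cycle_sign S C1 = (\<Prod>i\<in>?V1. arc_sign S (i, c1 i))"
      unfolding cycle_sign_def by (subst g1, subst prod.reindex) (auto simp: inj_on_def)
    thus ?thesis using even(1) card(1) by (simp add: prod_uminus)
  qed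
  have prod2: "(\<Prod>i\<in>?V2. - of_int (arc_sign S (i, c2 i))) = ?s2"
  proof -
    have "cycle_sign S C2 = (\<Prod>i\<in>?V2. arc_sign S (i, c2 i))"
      unfolding cycle_sign_def by (subst g2, subst prod.reindex) (auto simp: inj_on_def)
    thus ?thesis using even(2) card(2) by (simp add: prod_uminus)
  qed
  have prod12: "(\<Prod>i\<in>?V1 \<union> ?V2. - of_int (arc_sign S (i, (c1 \<circ> c2) i))) = ?s1 * ?s2"
  proof -
    have "(\<Prod>i\<in>?V1. - of_int (arc_sign S (i, (c1 \<circ> c2) i))) = ?s1"
      unfolding prod1[symmetric] by (intro prod.cong) (simp_all only: c12 if_True)
    moreover have "(\<Prod>i\<in>?V2. - of_int (arc_sign S (i, (c1 \<circ> c2) i))) = ?s2"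
      unfolding prod2[symmetric] using V by (intro prod.cong) (auto simp del: o_apply simp: c12)
    ultimately show ?thesis using V by (simp add: prod.union_disjoint del: o_apply)
  qed
  define F where "F = {id, c1, c2, c1 \<circ> c2}"
  let ?M = "char_poly_matrix (adj_matrix S)"
  let ?T = "\<lambda>p. signof p * (\<Prod>i=0..<n. ?M $$ (i, p i))"
  have A: "adj_matrix S \<in> carrier_mat n n" by (simp add: adj_matrix_def S Let_def)
  \<comment> \<open>A nonzero term forces an arc at every moved point, so each nontrivial orbit is
    one of the two directed cycles.\<close>
  have vanish: "?T p = 0" if p: "p permutes {0..<n}" "p \<notin> F" for p
  proof (rule ccontr)
    assume "?T p \<noteq> 0"
    hence nz: "?M $$ (i, p i) \<noteq> 0" if "i < n" for i
      using that by (auto simp: prod_zero_iff)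
    have arc: "(i, p i) \<in> ?E" if "p i \<noteq> i" for i
    proof -
      have "i < n" "p i < n" using that p permutes_not_in[OF p(1), of i]
          permutes_in_image[OF p(1), of i] by auto
      thus ?thesis using nz[of i] that
        by (auto simp: char_poly_matrix_def adj_matrix_def Let_def S split: if_splits)
    qed
    \<comment> \<open>An orbit through \<open>i\<close> that equals \<open>C1\<close> determines
      \<open>p\<close> on all of \<open>?V1\<close>, since \<open>C1\<close> is the graph of
      \<open>c1\<close>; likewise for \<open>C2\<close>.\<close>
    have cases: "(i \<in> ?V1 \<and> (\<forall>j\<in>?V1. p j = c1 j)) \<or> (i \<in> ?V2 \<and> (\<forall>j\<in>?V2. p j = c2 j))"
      if "p i \<noteq> i" for i
    proof -
      obtain U where U: "i \<in> U" "(\<lambda>j. (j, p j)) ` U \<in> dicycles S"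
      proof (rule orbit_dicycle[OF _ _ arc \<open>p i \<noteq> i\<close>])
        show "p permutes pverts (graph_of S)" "finite (pverts (graph_of S))" using p S by simp_all
      qed
      have "(\<lambda>j. (j, p j)) ` U = C1 \<or> (\<lambda>j. (j, p j)) ` U = C2"
        using U(2) unfolding cyc by (simp only: insert_iff empty_iff simp_thms)
      then consider "(\<lambda>j. (j, p j)) ` U = C1" | "(\<lambda>j. (j, p j)) ` U = C2" by (elim disjE)
      thus ?thesis
      proof cases
        case 1
        hence eq: "(\<lambda>j. (j, p j)) ` U = (\<lambda>j. (j, c1 j)) ` ?V1" unfolding g1[symmetric] .
        have "(i, p i) \<in> (\<lambda>j. (j, c1 j)) ` ?V1" using U(1) unfolding eq[symmetric] by (rule imageI)
        moreover have "p j = c1 j" if "j \<in> ?V1" for j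
        proof -
          have "(j, c1 j) \<in> (\<lambda>j. (j, p j)) ` U" using that unfolding eq by (rule imageI)
          thus ?thesis by auto
        qed
        ultimately show ?thesis by auto
      next
        case 2
        hence eq: "(\<lambda>j. (j, p j)) ` U = (\<lambda>j. (j, c2 j)) ` ?V2" unfolding g2[symmetric] .
        have "(i, p i) \<in> (\<lambda>j. (j, c2 j)) ` ?V2" using U(1) unfolding eq[symmetric] by (rule imageI)
        moreover have "p j = c2 j" if "j \<in> ?V2" for j
        proof -
          have "(j, c2 j) \<in> (\<lambda>j. (j, p j)) ` U" using that unfolding eq by (rule imageI)
          thus ?thesis by auto
        qed
        ultimately show ?thesis by auto
      qed
    qed
    \<comment> \<open>One moved point of \<open>?V1\<close> already forces agreement with
      \<open>c1\<close> on the whole of \<open>?V1\<close>.\<close>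
    have on1: "(\<forall>j\<in>?V1. p j = c1 j) \<or> (\<forall>j\<in>?V1. p j = j)" using cases V by blast
    have on2: "(\<forall>j\<in>?V2. p j = c2 j) \<or> (\<forall>j\<in>?V2. p j = j)" using cases V by blast
    have out: "p j = j" if "j \<notin> ?V1" "j \<notin> ?V2" for j using cases that by blast
    have ext: "p = f" if "\<And>j. j \<in> ?V1 \<Longrightarrow> p j = f j" "\<And>j. j \<in> ?V2 \<Longrightarrow> p j = f j"
      "\<And>j. j \<notin> ?V1 \<Longrightarrow> j \<notin> ?V2 \<Longrightarrow> f j = j" for f
    proof
      fix j show "p j = f j" using that[of j] out[of j] by (cases "j \<in> ?V1"; cases "j \<in> ?V2") auto
    qed
    have V': "j \<notin> ?V2" if "j \<in> ?V1" for j using V that by blast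
    have "p = id \<or> p = c1 \<or> p = c2 \<or> p = c1 \<circ> c2"
      using on1
    proof
      assume h1: "\<forall>j\<in>?V1. p j = c1 j"
      from on2 show ?thesis
      proof
        assume h2: "\<forall>j\<in>?V2. p j = c2 j"
        have "p = c1 \<circ> c2" by (rule ext) (use h1 h2 V' id2 in \<open>auto simp: c12 simp del: o_apply\<close>)
        thus ?thesis by blast
      next
        assume h2: "\<forall>j\<in>?V2. p j = j"
        have "p = c1" by (rule ext) (use h1 h2 V' id1 in metis)+
        thus ?thesis by blast
      qed
    next
      assume h1: "\<forall>j\<in>?V1. p j = j"
      from on2 show ?thesis
      proof
        assume h2: "\<forall>j\<in>?V2. p j = c2 j"
        have "p = c2" by (rule ext) (use h1 h2 V' id2 in metis)+
        thus ?thesis by blast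
      next
        assume h2: "\<forall>j\<in>?V2. p j = j"
        have "p = id" by (rule ext) (use h1 h2 in auto)
        thus ?thesis by blast
      qed
    qed
    thus False using p(2) by (auto simp: F_def)
  qed
  \<comment> \<open>The sum over the set \<open>F\<close> splits into four terms only if its members
    are different; a point from each cycle separates them.\<close>
  have distinct: "id \<noteq> c1" "id \<noteq> c2" "c1 \<noteq> c2" "id \<noteq> c1 \<circ> c2" "c1 \<noteq> c1 \<circ> c2" "c2 \<noteq> c1 \<circ> c2"
  proof -
    obtain i j where ij: "i \<in> ?V1" "j \<in> ?V2" using ne by (metis all_not_in_conv)
    hence vals: "c1 i \<noteq> i" "c2 i = i" "(c1 \<circ> c2) i \<noteq> i" "c1 j = j" "c2 j \<noteq> j" "(c1 \<circ> c2) j \<noteq> j"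
      using moved[of i] moved2[of j] id1[of j] id2[of i] V unfolding c12 by auto
    show "id \<noteq> c1" "id \<noteq> c2" "c1 \<noteq> c2" "id \<noteq> c1 \<circ> c2" "c1 \<noteq> c1 \<circ> c2" "c2 \<noteq> c1 \<circ> c2"
      using vals by (metis id_apply)+
  qed
  have "char_poly (adj_matrix S) = (\<Sum>p | p permutes {0..<n}. ?T p)"
    using det_def'[OF char_poly_matrix_closed[OF A]] by (simp add: char_poly_def)
  also have "\<dots> = (\<Sum>p\<in>F. ?T p)"
  proof (rule sum.mono_neutral_right)
    show "F \<subseteq> {p. p permutes {0..<n}}"
      using p1n p2n by (auto simp: F_def permutes_id permutes_compose)
  qed (use vanish in \<open>auto simp: finite_permutations\<close>)
  also have "\<dots> = ?T id + ?T c1 + ?T c2 + ?T (c1 \<circ> c2)"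
    unfolding F_def using distinct by (simp del: o_apply add: add.assoc)
  also have "?T id = monom 1 n"
    using adj_char_poly_matrix_prod[OF S, of "{}" id] by simp
  also have "?T c1 = - monom ?s1 (n - ?r1)"
    using adj_char_poly_matrix_prod[OF S Vn(1) E1 id1] prod1 card sg1 by simp
  also have "?T c2 = - monom ?s2 (n - ?r2)"
    using adj_char_poly_matrix_prod[OF S Vn(2) E2 id2] prod2 card sg2 by simp
  also have "?T (c1 \<circ> c2) = monom (?s1 * ?s2) (n - (?r1 + ?r2))"
  proof -
    have "(i, (c1 \<circ> c2) i) \<in> ?E" if "i \<in> ?V1 \<union> ?V2" for i
      using that E1 E2 unfolding c12 by auto
    moreover have "(c1 \<circ> c2) i = i" if "i \<notin> ?V1 \<union> ?V2" for i
      using that id2 unfolding c12 by auto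
    ultimately have "(\<Prod>i=0..<n. ?M $$ (i, (c1 \<circ> c2) i)) = monom (?s1 * ?s2) (n - (?r1 + ?r2))"
      using adj_char_poly_matrix_prod[OF S, of "?V1 \<union> ?V2" "c1 \<circ> c2"] Vn
      unfolding prod12 cardU by auto
    thus ?thesis using sg12 by simp
  qed
  also have "monom 1 n + - monom ?s1 (n - ?r1) + - monom ?s2 (n - ?r2)
      + monom (?s1 * ?s2) (n - (?r1 + ?r2)) =
    monom 1 (n - (?r1 + ?r2)) * ((monom 1 ?r1 - [:?s1:]) * (monom 1 ?r2 - [:?s2:]))"
  proof -
    have const: "[:a:] = monom a 0" for a :: complex by (simp add: monom_0)
    have "n - (?r1 + ?r2) + ?r1 = n - ?r2" "n - (?r1 + ?r2) + ?r2 = n - ?r1"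
      "n - (?r1 + ?r2) + (?r1 + ?r2) = n" using len by auto
    thus ?thesis
      unfolding const by (simp add: algebra_simps mult_monom)
  qed
  finally show "char_poly (adj_matrix S) = \<dots>" .
qed

section \<open>Iota energy of two disjoint even cycles\<close>

lemma cycle_sign_cases:
  assumes "is_sidigraph S" "C \<in> dicycles S"
  shows "cycle_sign S C \<in> {1, - 1}"
proof -
  have "finite C" "\<And>a. a \<in> C \<Longrightarrow> arc_sign S a \<in> {1, - 1}"
    using assms by (auto simp: dicycles_iff is_sidigraph_def)
  thus ?thesis unfolding cycle_sign_def
  proof (induction C rule: finite_induct)
    case (insert a F)
    hence "arc_sign S a \<in> {1, - 1}" "prod (arc_sign S) F \<in> {1, - 1}" by blast+
    thus ?case using insert.hyps by auto
  qed simp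
qed

text \<open>Roots of a product add up as multisets, and the monomial factor has only the root
  0.\<close>

lemma iota_energy_two_dicycles:
  assumes S: "is_sidigraph S" "pverts (graph_of S) = {0..<n}"
    and cyc: "dicycles S = {C1, C2}" and disj: "cycle_verts C1 \<inter> cycle_verts C2 = {}"
    and even: "even (cycle_length C1)" "even (cycle_length C2)"
    and pos: "0 < cycle_length C1" "0 < cycle_length C2"
  shows "iota_energy S = cycle_energy (cycle_length C1) (cycle_sign S C1)
    + cycle_energy (cycle_length C2) (cycle_sign S C2)"
proof -
  have sgn: "cycle_sign S C \<noteq> 0" if "C \<in> dicycles S" for C
    using cycle_sign_cases[OF S(1) that] by auto
  let ?q = "\<lambda>C. monom 1 (cycle_length C) - [:of_int (cycle_sign S C):] :: complex poly"
  have energy: "?q C \<noteq> 0 \<and> (\<Sum>z\<in>#proots (?q C). \<bar>Im z\<bar>) =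
      cycle_energy (cycle_length C) (cycle_sign S C)" if "C \<in> {C1, C2}" for C
  proof -
    have "0 < cycle_length C" "of_int (cycle_sign S C) \<noteq> (0::complex)"
      using that pos sgn cyc by auto
    \<comment> \<open>The witness is the constant coefficient, the negated cycle sign.\<close>
    moreover from this have "?q C \<noteq> 0" 
      by (auto simp: poly_eq_iff intro!: exI[of _ 0])
    ultimately show ?thesis
      by (simp add: proots_monom_diff_const cycle_energy_def sum_unfold_sum_mset)
  qed
  have "(\<Sum>z\<in>#proots (monom 1 k). \<bar>Im z\<bar>) = 0" for k
  proof -
    have "proots (monom (1::complex) k) = repeat_mset k {#0#}"
      by (simp add: monom_altdef proots_power)
    thus ?thesis by simp
  qed
  thus ?thesis
    unfolding iota_energy_def char_poly_two_dicycles(2)[OF S cyc disj even]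
    using energy[of C1] energy[of C2] by (simp add: proots_mult monom_eq_0_iff)
qed

section \<open>The extremal sidigraphs and their directed cycles\<close>

definition ring_arcs :: "nat \<Rightarrow> nat \<Rightarrow> (nat \<times> nat) set" where
  "ring_arcs a b = insert (b, a) ((\<lambda>i. (i, Suc i)) ` {a..<b})"

text \<open>A directed path through all vertices with two backward arcs, closing rings on
  \<open>{0..1}\<close> and \<open>{2..Suc m}\<close>. The path joins the rings and attaches the
  leftover vertices. Only the backward arcs carry \<open>s\<close>, so each ring has sign
  \<open>s\<close>.\<close>

definition two_ring_sidigraph :: "nat \<Rightarrow> nat \<Rightarrow> int \<Rightarrow> nat sidigraph" where
  "two_ring_sidigraph n m s =
    \<lparr>graph_of = \<lparr>pverts = {0..<n}, parcs = {(1, 0), (Suc m, 2)} \<union> (\<lambda>i. (i, Suc i)) ` {0..<n - 1}\<rparr>,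
     arc_sign = (\<lambda>(i, j). if j < i then s else 1)\<rparr>"

lemma cycle_verts_ring_arcs: "a \<le> b \<Longrightarrow> cycle_verts (ring_arcs a b) = {a..b}"
  by (auto simp: cycle_verts_def ring_arcs_def image_image)

lemma cycle_length_ring_arcs: "a \<le> b \<Longrightarrow> cycle_length (ring_arcs a b) = Suc b - a"
  by (simp add: cycle_length_def cycle_verts_ring_arcs)

lemma cycle_sign_ring_arcs:
  assumes "a < b"
  shows "cycle_sign (two_ring_sidigraph n m s) (ring_arcs a b) = s"
proof -
  let ?f = "arc_sign (two_ring_sidigraph n m s)"
  have "cycle_sign (two_ring_sidigraph n m s) (ring_arcs a b) =
    ?f (b, a) * prod ?f ((\<lambda>i. (i, Suc i)) ` {a..<b})"
    unfolding cycle_sign_def ring_arcs_def using assms by (subst prod.insert) auto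
  also have "prod ?f ((\<lambda>i. (i, Suc i)) ` {a..<b}) = 1"
    by (intro prod.neutral) (auto simp: two_ring_sidigraph_def)
  finally show ?thesis using assms by (simp add: two_ring_sidigraph_def)
qed

lemma ring_arcs_dicycle:
  assumes "a \<le> b" "ring_arcs a b \<subseteq> parcs (graph_of S)" "a \<in> pverts (graph_of S)"
  shows "ring_arcs a b \<in> dicycles S"
proof -
  let ?p = "map (\<lambda>i. (i, Suc i)) [a..<b] @ [(b, a)]"
  have "pcas a (map (\<lambda>i. (i, Suc i)) [a..<b]) b"
    using assms(1) by (induction b rule: dec_induct) (auto simp: pcas_append)
  hence "pcas a ?p a" by (auto simp: pcas_append)
  moreover have "set ?p = ring_arcs a b" by (auto simp: ring_arcs_def)
  moreover have "distinct (map snd ?p)" by (auto simp: distinct_map o_def inj_on_def)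
  moreover have "?p \<noteq> []" by simp
  ultimately show ?thesis using assms unfolding dicycles_iff by metis
qed

lemma dicycle_closed_succ:
  assumes "C \<in> dicycles S" "(x, y) \<in> C"
  obtains z where "(y, z) \<in> C"
proof -
  from assms(1) obtain u p where p: "pcas u p u" "p \<noteq> []" "C = set p"
    unfolding dicycles_iff by blast
  have "set (u # map snd p) = set (map fst p @ [u])" using pcas_verts_eq[OF p(1)] by simp
  moreover have "u \<in> set (map fst p)" using p by (cases p) auto
  ultimately have "snd ` C = fst ` C \<or> snd ` C \<subseteq> fst ` C" by (auto simp: p(3))
  hence "y \<in> fst ` C" using assms(2) by force
  thus ?thesis using that by force
qed

text \<open>A quantity that never decreases along arcs cannot increase on a walk that returns to its
  start.\<close>

lemma dicycle_level_constant:
  fixes l :: "'a \<Rightarrow> 'b :: order"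
  assumes "C \<in> dicycles S" "\<And>x y. (x, y) \<in> parcs (graph_of S) \<Longrightarrow> l x \<le> l y"
  shows "\<exists>c. \<forall>x y. (x, y) \<in> C \<longrightarrow> l x = c \<and> l y = c"
proof -
  from assms(1) obtain u p where p: "pcas u p u" "set p \<subseteq> parcs (graph_of S)" "C = set p"
    unfolding dicycles_iff by blast
  \<comment> \<open>Stated for open walks to allow induction; equal endpoints then squeeze all
    levels together.\<close>
  have walk: "l v \<le> l w \<and> (\<forall>(x, y)\<in>set q. l v \<le> l x \<and> l x \<le> l y \<and> l y \<le> l w)"
    if "pcas v q w" "set q \<subseteq> parcs (graph_of S)" for v q w
    using that
  proof (induction q arbitrary: v)
    case (Cons e q)
    obtain y where e: "e = (v, y)" using Cons.prems(1) by (cases e) auto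
    have "l v \<le> l y" using Cons.prems(2) e assms(2) by auto
    moreover have "l y \<le> l w \<and> (\<forall>(x, z)\<in>set q. l y \<le> l x \<and> l x \<le> l z \<and> l z \<le> l w)"
      using Cons e by auto
    ultimately show ?case using e by (auto intro: order_trans)
  qed simp
  have "l x = l u \<and> l y = l u" if "(x, y) \<in> C" for x y
    using walk[OF p(1,2)] that p(3) by (fastforce intro: antisym order_trans)
  thus ?thesis by blast
qed

text \<open>Every vertex of a ring has a single outgoing arc, so closure under successors carries
  any one arc up to \<open>b\<close>, across \<open>(b, a)\<close> and around the rest of the
  ring.\<close>

lemma ring_arcs_eqI:
  assumes "C \<subseteq> ring_arcs a b" "C \<noteq> {}" "a \<le> b"
    and closed: "\<And>x y. (x, y) \<in> C \<Longrightarrow> \<exists>z. (y, z) \<in> C"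
  shows "C = ring_arcs a b"
proof -
  have up: "(i, Suc i) \<in> C \<Longrightarrow> Suc i < b \<Longrightarrow> (Suc i, Suc (Suc i)) \<in> C" for i
    using closed[of i "Suc i"] assms(1) by (auto simp: ring_arcs_def)
  have climb: "(j, Suc j) \<in> C" if "(i, Suc i) \<in> C" "i \<le> j" "j < b" for i j
    using that(2,3) by (induction j rule: dec_induct) (use that(1) up in auto)
  have top: "(b, a) \<in> C"
  proof -
    obtain x y where xy: "(x, y) \<in> C" using assms(2) by auto
    show ?thesis
    proof (cases "(x, y) = (b, a)")
      case False
      with xy assms(1) have x: "y = Suc x" "x < b" by (auto simp: ring_arcs_def)
      have "(b - 1, b) \<in> C" using climb[of x "b - 1"] xy x by auto
      then obtain z where "(b, z) \<in> C" using closed by blast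
      moreover from this have "z = a" using assms(1) by (auto simp: ring_arcs_def)
      ultimately show ?thesis by simp
    qed (use xy in simp)
  qed
  have "(a, Suc a) \<in> C" if "a < b"
    using closed[OF top] assms(1) that by (auto simp: ring_arcs_def)
  hence "(j, Suc j) \<in> C" if "a \<le> j" "j < b" for j
    using climb[of a j] that by auto
  thus ?thesis using top assms(1) by (auto simp: ring_arcs_def)
qed

lemma is_sidigraph_two_ring:
  assumes "2 \<le> m" "m + 2 \<le> n" "s \<in> {1, - 1}"
  shows "is_sidigraph (two_ring_sidigraph n m s)"
  unfolding is_sidigraph_def two_ring_sidigraph_def
  using assms by (auto intro!: pair_digraph.intro pair_fin_digraph.intro pair_wf_digraph.intro
      pair_loopfree_digraph.intro pair_fin_digraph_axioms.intro pair_loopfree_digraph_axioms.intro)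

text \<open>In the symmetric closure the path can be walked both ways, so any two vertices are
  joined through 0.\<close>

lemma sidigraph_connected_two_ring:
  assumes "2 \<le> m" "m + 2 \<le> n" "s \<in> {1, - 1}"
  shows "sidigraph_connected (two_ring_sidigraph n m s)"
proof -
  let ?G = "graph_of (two_ring_sidigraph n m s)"
  interpret pair_digraph ?G using is_sidigraph_two_ring[OF assms] by (simp add: is_sidigraph_def)
  let ?H = "mk_symmetric (with_proj ?G)"
  interpret H: pair_wf_digraph ?H by (rule wellformed_mk_symmetric)
  have verts: "pverts ?H = {0..<n}" by (simp add: two_ring_sidigraph_def)
  have "(0, i) \<in> rtrancl_on (pverts ?H) (parcs ?H) \<and> (i, 0) \<in> rtrancl_on (pverts ?H) (parcs ?H)"
    if "i < n" for i
    using that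
  proof (induction i)
    case 0
    thus ?case using assms verts by auto
  next
    case (Suc i)
    have "(i, Suc i) \<in> parcs ?G" using Suc.prems by (auto simp: two_ring_sidigraph_def)
    hence "(i, Suc i) \<in> parcs ?H" "(Suc i, i) \<in> parcs ?H" 
      by (auto simp: parcs_mk_symmetric intro: bexI[of _ "(i, Suc i)"])
    moreover have "i \<in> pverts ?H" "Suc i \<in> pverts ?H" using Suc.prems verts by auto
    ultimately show ?case using Suc
      by (metis Suc_lessD rtrancl_on_into_rtrancl_on converse_rtrancl_on_into_rtrancl_on)
  qed
  hence "(i, j) \<in> rtrancl_on (pverts ?H) (parcs ?H)" if "i < n" "j < n" for i j
    using that rtrancl_on_trans by metis
  thus ?thesis
    unfolding sidigraph_connected_def connected_def strongly_connected_def reachable_def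
    using assms verts by auto
qed

lemma dicycles_two_ring:
  assumes "2 \<le> m" "m + 2 \<le> n" "s \<in> {1, - 1}"
  shows "dicycles (two_ring_sidigraph n m s) = {ring_arcs 0 1, ring_arcs 2 (Suc m)}"
proof (intro equalityI subsetI)
  let ?S = "two_ring_sidigraph n m s"
  fix C assume "C \<in> {ring_arcs 0 1, ring_arcs 2 (Suc m)}"
  moreover have "ring_arcs 0 1 \<in> dicycles ?S"
    using assms by (intro ring_arcs_dicycle) (auto simp: two_ring_sidigraph_def ring_arcs_def)
  moreover have "ring_arcs 2 (Suc m) \<in> dicycles ?S"
    using assms by (intro ring_arcs_dicycle) (auto simp: two_ring_sidigraph_def ring_arcs_def)
  ultimately show "C \<in> dicycles ?S" by auto
next
  let ?S = "two_ring_sidigraph n m s"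
  fix C assume C: "C \<in> dicycles ?S"
  have E: "parcs (graph_of ?S) = {(1, 0), (Suc m, 2)} \<union> (\<lambda>i. (i, Suc i)) ` {0..<n - 1}"
    by (simp add: two_ring_sidigraph_def)
  \<comment> \<open>Each ring is collapsed to one level and later vertices keep their own. Backward
    arcs stay within a level, while path arcs outside the rings raise it, so a directed cycle is
    confined to one ring.\<close>
  define l where "l = (\<lambda>i::nat. if i \<le> 1 then 0 else if i \<le> Suc m then 1 else i)"
  have mono: "l x \<le> l y" if "(x, y) \<in> parcs (graph_of ?S)" for x y
    using that assms by (auto simp: E l_def)
  obtain c where c: "\<And>x y. (x, y) \<in> C \<Longrightarrow> l x = c \<and> l y = c"
    using dicycle_level_constant[of C ?S l, OF C mono] by blast
  have CE: "C \<subseteq> parcs (graph_of ?S)" and ne: "C \<noteq> {}" using C by (auto simp: dicycles_iff)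
  have closed: "\<exists>z. (y, z) \<in> C" if "(x, y) \<in> C" for x y
    by (rule dicycle_closed_succ[OF C that]) blast
  have arc: "(x, y) \<in> ring_arcs 0 1 \<and> l x = 0 \<or> (x, y) \<in> ring_arcs 2 (Suc m) \<and> l x = 1"
    if "(x, y) \<in> C" for x y
  proof -
    have eq: "l x = l y" using c[OF that] by simp
    have "(x, y) = (1, 0) \<or> (x, y) = (Suc m, 2) \<or> y = Suc x"
      using CE that by (auto simp: E)
    thus ?thesis
    proof (elim disjE)
      assume y: "y = Suc x"
      have "x = 0 \<or> 2 \<le> x \<and> x \<le> m"
        using eq unfolding y l_def by (simp split: if_splits)
      thus ?thesis unfolding y by (auto simp: l_def ring_arcs_def)
    qed (use assms in \<open>auto simp: l_def ring_arcs_def\<close>)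
  qed
  have "C \<subseteq> ring_arcs 0 1 \<or> C \<subseteq> ring_arcs 2 (Suc m)"
  proof (cases "c = 0")
    case True
    have "C \<subseteq> ring_arcs 0 1"
      using arc c True by (intro subrelI) (metis zero_neq_one)
    thus ?thesis ..
  next
    case False
    have "C \<subseteq> ring_arcs 2 (Suc m)"
      using arc c False by (intro subrelI) metis
    thus ?thesis ..
  qed
  thus "C \<in> {ring_arcs 0 1, ring_arcs 2 (Suc m)}"
  proof
    assume "C \<subseteq> ring_arcs 0 1"
    hence "C = ring_arcs 0 1" by (rule ring_arcs_eqI[OF _ ne _ closed]) simp_all
    thus ?thesis by blast
  next
    assume "C \<subseteq> ring_arcs 2 (Suc m)"
    hence "C = ring_arcs 2 (Suc m)"
      by (rule ring_arcs_eqI[OF _ ne _ closed]) (use assms in simp_all)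
    thus ?thesis by blast
  qed
qed

section \<open>Extremal energies over the class\<close>

text \<open>Reduces the optimisation to two lengths and two signs; \<open>a + b \<le> n\<close>
  expresses that the cycles are disjoint.\<close>

lemma two_even_cycle_class_energy:
  assumes "T \<in> two_even_cycle_class n"
  obtains a b s t where "even a" "2 \<le> a" "even b" "2 \<le> b" "a + b \<le> n"
    "s \<in> {1, - 1}" "t \<in> {1, - 1}" "iota_energy T = cycle_energy a s + cycle_energy b t"
proof -
  have T: "is_sidigraph T" "pverts (graph_of T) = {0..<n}"
    and "\<exists>C1 C2. C1 \<noteq> C2 \<and> dicycles T = {C1, C2} \<and> cycle_verts C1 \<inter> cycle_verts C2 = {} \<and>
      (\<forall>C \<in> {C1, C2}. even (cycle_length C) \<and> 2 \<le> cycle_length C \<and> cycle_length C \<le> n - 2)"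
    using assms unfolding two_even_cycle_class_def mem_Collect_eq by (simp_all only: simp_thms)
  then obtain C1 C2 where cyc: "dicycles T = {C1, C2}"
    and disj: "cycle_verts C1 \<inter> cycle_verts C2 = {}"
    and "\<forall>C \<in> {C1, C2}. even (cycle_length C) \<and> 2 \<le> cycle_length C \<and> cycle_length C \<le> n - 2"
    by (elim exE conjE)
  from this(3) have len: "even (cycle_length C1)" "even (cycle_length C2)"
      "2 \<le> cycle_length C1" "2 \<le> cycle_length C2"
    by simp_all
  have mem: "C1 \<in> dicycles T" "C2 \<in> dicycles T" using cyc by auto
  show ?thesis
  proof (rule that[OF len(1,3,2,4)])
    show "cycle_length C1 + cycle_length C2 \<le> n"
      by (rule char_poly_two_dicycles(1)[OF T cyc disj len(1,2)])
    show "iota_energy T = cycle_energy (cycle_length C1) (cycle_sign T C1)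
        + cycle_energy (cycle_length C2) (cycle_sign T C2)"
      using len(3,4) by (intro iota_energy_two_dicycles[OF T cyc disj len(1,2)]) simp_all
  qed (rule cycle_sign_cases[OF T(1)] mem)+
qed

lemma two_ring_sidigraph_class:
  fixes n m :: nat and s :: int
  defines "S \<equiv> two_ring_sidigraph n m s"
  assumes "2 \<le> m" "even m" "m + 2 \<le> n" "s \<in> {1, - 1}"
  shows "S \<in> two_even_cycle_class n"
    and "dicycles S = {ring_arcs 0 1, ring_arcs 2 (Suc m)}"
    and "ring_arcs 0 1 \<noteq> ring_arcs 2 (Suc m)"
    and "cycle_length (ring_arcs 0 1) = 2" "cycle_sign S (ring_arcs 0 1) = s"
    and "cycle_length (ring_arcs 2 (Suc m)) = m" "cycle_sign S (ring_arcs 2 (Suc m)) = s"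
    and "iota_energy S = cycle_energy 2 s + cycle_energy m s"
proof -
  let ?C1 = "ring_arcs 0 1" and ?C2 = "ring_arcs 2 (Suc m)"
  show cyc: "dicycles S = {?C1, ?C2}" unfolding S_def by (rule dicycles_two_ring) fact+
  have disj: "cycle_verts ?C1 \<inter> cycle_verts ?C2 = {}"
    using assms by (simp add: cycle_verts_ring_arcs)
  have "(1, 0) \<in> ?C1" "(1, 0) \<notin> ?C2" by (auto simp: ring_arcs_def)
  thus ne: "?C1 \<noteq> ?C2" by metis
  show len1: "cycle_length ?C1 = 2" and len2: "cycle_length ?C2 = m"
    using assms by (simp_all add: cycle_length_ring_arcs)
  show sg: "cycle_sign S ?C1 = s" "cycle_sign S ?C2 = s"
    using assms by (simp_all add: cycle_sign_ring_arcs)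
  have S: "is_sidigraph S" "pverts (graph_of S) = {0..<n}"
    using is_sidigraph_two_ring[of m n s] assms by (simp_all add: two_ring_sidigraph_def)
  have "sidigraph_connected S"
    using sidigraph_connected_two_ring[of m n s] assms by simp
  thus "S \<in> two_even_cycle_class n"
    unfolding two_even_cycle_class_def mem_Collect_eq
    using S cyc disj ne len1 len2 assms
    by (intro conjI exI[of _ ?C1] exI[of _ ?C2]) auto
  show "iota_energy S = cycle_energy 2 s + cycle_energy m s"
    using iota_energy_two_dicycles[OF S cyc disj] len1 len2 sg assms by simp
qed

text \<open>The range for \<open>n\<close> covers both parities: \<open>m = n - 2\<close> for even
  \<open>n\<close> and \<open>m = n - 3\<close> for odd \<open>n\<close>.\<close>

lemma iota_energy_le_two_ring:
  assumes "T \<in> two_even_cycle_class n" "2 \<le> m" "even m" "m + 2 \<le> n" "n \<le> m + 3"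
  shows "iota_energy T \<le> iota_energy (two_ring_sidigraph n m (- 1))"
proof -
  from assms(1) obtain a b s t where ab: "even a" "2 \<le> a" "even b" "2 \<le> b" "a + b \<le> n"
    "s \<in> {1, - 1}" "t \<in> {1, - 1}" and T: "iota_energy T = cycle_energy a s + cycle_energy b t"
    by (rule two_even_cycle_class_energy)
  \<comment> \<open>Parity: an even sum cannot use all vertices when \<open>n = m + 3\<close> is
    odd, so one vertex stays off the cycles.\<close>
  have "a + b \<noteq> m + 3" using ab assms by (metis even_add odd_numeral)
  hence "a + b \<le> m + 2" using ab assms by linarith
  thus ?thesis
    using cycle_energy_sum_le[of a b m s t] ab assms T two_ring_sidigraph_class(8)[of m n "- 1"]
    by simp
qed

lemma iota_energy_max_attained:
  assumes "2 \<le> m" "even m" "m + 2 \<le> n" "n \<le> m + 3"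
  shows "\<exists>S\<in>two_even_cycle_class n.
    (\<exists>C1 C2. C1 \<noteq> C2 \<and> dicycles S = {C1, C2} \<and> is_neg_cycle S 2 C1 \<and> is_neg_cycle S m C2) \<and>
    (\<forall>T\<in>two_even_cycle_class n. iota_energy T \<le> iota_energy S)"
proof (intro bexI conjI exI ballI)
  let ?S = "two_ring_sidigraph n m (- 1)"
  have "- 1 \<in> {1, - 1 :: int}" by simp
  note ring = two_ring_sidigraph_class[OF assms(1-3) this]
  show "ring_arcs 0 1 \<noteq> ring_arcs 2 (Suc m)" "dicycles ?S = {ring_arcs 0 1, ring_arcs 2 (Suc m)}"
    "?S \<in> two_even_cycle_class n"
    by (fact ring)+
  show "is_neg_cycle ?S 2 (ring_arcs 0 1)" "is_neg_cycle ?S m (ring_arcs 2 (Suc m))"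
    unfolding is_neg_cycle_def ring(2,4-7) by simp_all
  show "iota_energy T \<le> iota_energy ?S" if "T \<in> two_even_cycle_class n" for T
    using iota_energy_le_two_ring[OF that assms] .
qed

lemma iota_energy_min_attained:
  assumes "4 \<le> n"
  shows "\<exists>S\<in>two_even_cycle_class n.
    (\<exists>C1 C2. C1 \<noteq> C2 \<and> dicycles S = {C1, C2} \<and> is_pos_cycle S 2 C1 \<and> is_pos_cycle S 2 C2) \<and>
    (\<forall>T\<in>two_even_cycle_class n. iota_energy S \<le> iota_energy T)"
proof (intro bexI conjI exI ballI)
  let ?S = "two_ring_sidigraph n 2 1"
  have "2 \<le> (2::nat)" "even (2::nat)" "2 + 2 \<le> n" "1 \<in> {1, - 1 :: int}" using assms by auto
  note ring = two_ring_sidigraph_class[OF this]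
  show "ring_arcs 0 1 \<noteq> ring_arcs 2 (Suc 2)" "dicycles ?S = {ring_arcs 0 1, ring_arcs 2 (Suc 2)}"
    "?S \<in> two_even_cycle_class n"
    by (fact ring)+
  show "is_pos_cycle ?S 2 (ring_arcs 0 1)" "is_pos_cycle ?S 2 (ring_arcs 2 (Suc 2))"
    unfolding is_pos_cycle_def ring(2,4-7) by simp_all
  show "iota_energy ?S \<le> iota_energy T" if "T \<in> two_even_cycle_class n" for T
  proof -
    \<comment> \<open>Both cycles contribute a multiple of \<open>cos (pi / 2)\<close>; their
      eigenvalues are the real numbers 1 and -1.\<close>
    have "iota_energy ?S = 0" unfolding ring(8) by (simp add: cycle_energy_pos)
    also have "0 \<le> iota_energy T"
      using that by (rule two_even_cycle_class_energy) (simp add: cycle_energy_nonneg)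
    finally show ?thesis .
  qed
qed

theorem theorem3p7:
  fixes n :: nat
  assumes "4 \<le> n"
  shows "(even n \<longrightarrow>
           (\<exists>S \<in> two_even_cycle_class n.
             (\<exists>C1 C2. C1 \<noteq> C2 \<and> dicycles S = {C1, C2} \<and>
                is_neg_cycle S 2 C1 \<and> is_neg_cycle S (n - 2) C2) \<and>
             (\<forall>T \<in> two_even_cycle_class n. iota_energy T \<le> iota_energy S))) \<and>
         (odd n \<longrightarrow>
           (\<exists>S \<in> two_even_cycle_class n.
             (\<exists>C1 C2. C1 \<noteq> C2 \<and> dicycles S = {C1, C2} \<and>
                is_neg_cycle S 2 C1 \<and> is_neg_cycle S (n - 3) C2) \<and>
             (\<forall>T \<in> two_even_cycle_class n. iota_energy T \<le> iota_energy S))) \<and>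
         (\<exists>S \<in> two_even_cycle_class n.
             (\<exists>C1 C2. C1 \<noteq> C2 \<and> dicycles S = {C1, C2} \<and>
                is_pos_cycle S 2 C1 \<and> is_pos_cycle S 2 C2) \<and>
             (\<forall>T \<in> two_even_cycle_class n. iota_energy S \<le> iota_energy T))"
proof (intro conjI impI)
  assume "even n"
  thus "\<exists>S\<in>two_even_cycle_class n.
      (\<exists>C1 C2. C1 \<noteq> C2 \<and> dicycles S = {C1, C2} \<and> is_neg_cycle S 2 C1 \<and> is_neg_cycle S (n - 2) C2) \<and>
      (\<forall>T\<in>two_even_cycle_class n. iota_energy T \<le> iota_energy S)"
    using assms by (intro iota_energy_max_attained) auto
next
  assume "odd n"
  \<comment> \<open>Hence \<open>n\<close> is at least 5, which makes \<open>n - 3\<close> an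
    admissible length.\<close>
  moreover from this have "n \<noteq> 4" by auto
  ultimately show "\<exists>S\<in>two_even_cycle_class n.
      (\<exists>C1 C2. C1 \<noteq> C2 \<and> dicycles S = {C1, C2} \<and> is_neg_cycle S 2 C1 \<and> is_neg_cycle S (n - 3) C2) \<and>
      (\<forall>T\<in>two_even_cycle_class n. iota_energy T \<le> iota_energy S)"
    using assms by (intro iota_energy_max_attained) auto
qed (rule iota_energy_min_attained[OF assms])

end
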